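(* Let $q\in\{3,4\}$ and $d\ge 1$ be integers, and let $T$ be the complete $q$-ary tree of depth $d$. Then \[\Phi_V(T)\ge d-\log_q(d)-\big(\log_q(2)+1\big).\]
   Context: The complete $q$-ary tree of depth $d$ is the rooted tree in which every vertex at distance less than $d$ from the root has exactly $q$ children, and the vertices at distance $d$ from the root are leaves. For a graph $G$ and $S\subseteq V(G)$, $\delta(S)=\{v\in V(G)\setminus S : N(v)\cap S\neq\emptyset\}$; $\Phi_V(G,s)=\min_{|S|=s}|\delta(S)|$ and $\Phi_V(G)=\max_{0\le s\le |V(G)|}\Phi_V(G,s)$. *)

theory Defs
  imports Complex_Main "Graph_Theory.Graph_Theory"
begin

text \<open>
  A finite simple graph is a \<^locale>\<open>pair_graph\<close>: finite, loop-free, with a symmetric arc relation,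
  so that an undirected edge is a pair of opposite arcs.
\<close>

section \<open>Vertex isoperimetry\<close>

definition nbhd :: "'a pair_pre_digraph \<Rightarrow> 'a \<Rightarrow> 'a set" where
  "nbhd G v = {w. (v, w) \<in> parcs G}"

definition vertex_boundary :: "'a pair_pre_digraph \<Rightarrow> 'a set \<Rightarrow> 'a set" where
  "vertex_boundary G S = {v \<in> pverts G - S. nbhd G v \<inter> S \<noteq> {}}"

definition Phi_V_at :: "'a pair_pre_digraph \<Rightarrow> nat \<Rightarrow> nat" where
  "Phi_V_at G s = Min {card (vertex_boundary G S) |S. S \<subseteq> pverts G \<and> card S = s}"

definition Phi_V :: "'a pair_pre_digraph \<Rightarrow> nat" where
  "Phi_V G = Max {Phi_V_at G s |s. s \<le> card (pverts G)}"

section \<open>Rooted trees\<close>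

text \<open>Every edge walked back and forth is a \<^const>\<open>pre_digraph.cycle\<close> of length 2, so the
  library's \<^const>\<open>tree\<close> is never satisfied by a symmetric digraph with an arc. The cycles of the
  underlying undirected graph are those of length at least 3.\<close>

locale rooted_tree = pair_graph G for G :: "'a pair_pre_digraph" +
  fixes r :: 'a
  assumes root_in_verts: "r \<in> pverts G"
    and connected: "Digraph_Component.connected (with_proj G)"
    and acyclic: "\<not> (\<exists>p. cycle p \<and> 3 \<le> length p)"
begin

definition depth :: "'a \<Rightarrow> ereal" where
  "depth v = \<mu> (\<lambda>_. 1) r v"

definition children :: "'a \<Rightarrow> 'a set" where
  "children v = {w \<in> nbhd G v. depth w = depth v + 1}"

end

locale complete_qary_tree = rooted_tree G r for G :: "'a pair_pre_digraph" and r :: 'a +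
  fixes q d :: nat
  assumes card_children: "\<lbrakk>v \<in> pverts G; depth v < ereal (real d)\<rbrakk> \<Longrightarrow> card (children v) = q"
    and leaves: "\<lbrakk>v \<in> pverts G; depth v = ereal (real d)\<rbrakk> \<Longrightarrow> children v = {}"

end

theory Submission
  imports Defs
begin

text \<open>
  Give a vertex at height \<open>h\<close> the weight \<open>q^(h+1) - 1\<close>, which is \<open>q - 1\<close> times the size of the
  subtree below it. Telescoping along the edges writes \<open>(q - 1) |S|\<close> as a sum over the boundary of
  \<open>S\<close> of terms \<open>c (q^h - 1) - e (q^(h+1) - 1)\<close> with \<open>0 \<le> c \<le> q\<close> and \<open>e \<in> {0, 1}\<close>, plus
  \<open>q^(d+1) - 1\<close> if the root lies in \<open>S\<close>. Hence, up to an error linear in \<open>q |\<delta>(S)|\<close>, the number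
  \<open>(q - 1) |S|\<close> is modulo \<open>q^(d+1)\<close> a sum of \<open>|\<delta>(S)|\<close> terms \<open>a q^h\<close> with \<open>\<bar>a\<bar> \<le> q\<close>.
  A number that has many base-\<open>q\<close> digits other than \<open>0\<close> and \<open>q - 1\<close> needs as many such terms,
  because the carries are confined to \<open>{0, 1}\<close>. Taking \<open>(q - 1) s\<close> with all digits
  equal to \<open>1\<close> except for about \<open>log\<^sub>q (2 q d)\<close> low ones, which absorb the error, gives the bound.
\<close>

section \<open>Signed base-\<open>q\<close> representations\<close>

text \<open>The digits \<open>0\<close> and \<open>q - 1\<close> are left out because carries in
  \<open>{0, 1}\<close> cross them at no cost: \<open>0\<close> passes on carry \<open>0\<close>,
  and \<open>q - 1\<close> passes on carry \<open>1\<close>.\<close>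

definition inner_digits :: "int \<Rightarrow> nat \<Rightarrow> int \<Rightarrow> nat set" where
  "inner_digits q n N = {j. j < n \<and> N div q ^ j mod q \<in> {1..q - 2}}"

lemma card_inner_digits_Suc:
  assumes "q > 0"
  shows "card (inner_digits q (Suc n) N)
    = (if N mod q \<in> {1..q - 2} then 1 else 0) + card (inner_digits q n (N div q))"
proof -
  have shift: "N div q ^ Suc j = N div q div q ^ j" for j
    using assms by (simp add: zdiv_zmult2_eq)
  have eq: "inner_digits q (Suc n) N
      = (if N mod q \<in> {1..q - 2} then {0} else {}) \<union> Suc ` inner_digits q n (N div q)"
  proof (rule set_eqI)
    fix j
    show "j \<in> inner_digits q (Suc n) N \<longleftrightarrow>
      j \<in> (if N mod q \<in> {1..q - 2} then {0} else {}) \<union> Suc ` inner_digits q n (N div q)"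
      by (cases j) (auto simp: inner_digits_def shift simp del: power_Suc)
  qed
  have "finite (inner_digits q n (N div q))"
    by (simp add: inner_digits_def)
  then show ?thesis
    unfolding eq by (auto simp: card_image card_insert_if)
qed

text \<open>The slack \<open>max (c - 1) (- c)\<close> is the distance of the carry \<open>c\<close> from \<open>{0, 1}\<close>: a carry
  outside that set has been paid for by surplus terms at lower positions.\<close>

lemma card_inner_digits_le:
  fixes q N c :: int and a :: "'b \<Rightarrow> int"
  assumes "q \<ge> 2" and "finite B" and "\<And>v. v \<in> B \<Longrightarrow> \<bar>a v\<bar> \<le> q"
    and "q ^ n dvd N + c - (\<Sum>v\<in>B. a v * q ^ h v)"
  shows "int (card (inner_digits q n N)) \<le> int (card B) + max 0 (max (c - 1) (- c))"
  using assms
proof (induction n arbitrary: B N c h)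
  case 0
  then show ?case by (simp add: inner_digits_def)
next
  case (Suc n)
  \<comment> \<open>Only terms with exponent \<open>0\<close> affect the lowest digit; the others
    are divided by \<open>q\<close> and passed to the induction hypothesis.\<close>
  define B0 B1 where "B0 = {v \<in> B. h v = 0}" and "B1 = {v \<in> B. h v \<noteq> 0}"
  define A where "A = (\<Sum>v\<in>B0. a v)"
  define h' where "h' v = h v - 1" for v
  define X where "X = (\<Sum>v\<in>B1. a v * q ^ h' v)"
  define d0 where "d0 = N mod q"
  have fin: "finite B0" "finite B1" and B: "B = B0 \<union> B1" "B0 \<inter> B1 = {}"
    using Suc.prems(2) by (auto simp: B0_def B1_def)
  have cardB: "card B = card B0 + card B1"
    using fin B by (simp add: card_Un_disjoint)
  have "(\<Sum>v\<in>B. a v * q ^ h v) = (\<Sum>v\<in>B0. a v * q ^ h v) + (\<Sum>v\<in>B1. a v * q ^ h v)"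
    using fin B by (simp add: sum.union_disjoint)
  also have "(\<Sum>v\<in>B0. a v * q ^ h v) = A"
    unfolding A_def by (rule sum.cong) (auto simp: B0_def)
  also have "(\<Sum>v\<in>B1. a v * q ^ h v) = (\<Sum>v\<in>B1. q * (a v * q ^ h' v))"
  proof (rule sum.cong)
    fix v assume "v \<in> B1"
    then have "q ^ h v = q * q ^ h' v"
      by (cases "h v") (auto simp: B1_def h'_def)
    then show "a v * q ^ h v = q * (a v * q ^ h' v)" by simp
  qed simp
  also have "\<dots> = q * X" by (simp add: X_def sum_distrib_left)
  finally have "q ^ Suc n dvd N + c - (A + q * X)"
    using Suc.prems(4) by simp
  then obtain y where y: "N + c - (A + q * X) = q * q ^ n * y"
    by (auto elim: dvdE)
  have N: "N = q * (N div q) + d0" by (simp add: d0_def)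
  \<comment> \<open>The carry into the next position: it restores the divisibility hypothesis for
    \<open>N div q\<close>, and comparison with \<open>y\<close> gives
    \<open>q * c' = d0 + c - A\<close>.\<close>
  define c' where "c' = X + q ^ n * y - N div q"
  have c': "q * c' = d0 + c - A"
    using y N unfolding c'_def by (simp add: algebra_simps)
  have d0: "0 \<le> d0" "d0 \<le> q - 1" using Suc.prems(1) by (auto simp: d0_def)
  have A: "\<bar>A\<bar> \<le> q * int (card B0)"
  proof -
    have "\<bar>A\<bar> \<le> (\<Sum>v\<in>B0. \<bar>a v\<bar>)" unfolding A_def by (rule sum_abs)
    also have "\<dots> \<le> (\<Sum>v\<in>B0. q)"
      by (rule sum_mono) (use Suc.prems(3) in \<open>auto simp: B0_def\<close>)
    finally show ?thesis by (simp add: mult.commute)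
  qed
  have "int (card (inner_digits q n (N div q))) \<le> int (card B1) + max 0 (max (c' - 1) (- c'))"
  proof (rule Suc.IH)
    show "q ^ n dvd N div q + c' - (\<Sum>v\<in>B1. a v * q ^ h' v)"
      by (simp add: c'_def flip: X_def)
  qed (use Suc.prems fin B in auto)
  \<comment> \<open>Balance at one position: an inner digit together with the new slack is paid for
    by the terms in \<open>B0\<close> and the old slack. The three bounds below treat the arms of
    the maximum.\<close>
  moreover have "(if d0 \<in> {1..q - 2} then 1 else 0) + max 0 (max (c' - 1) (- c'))
      \<le> int (card B0) + max 0 (max (c - 1) (- c))"
  proof -
    define k where "k = int (card B0)"
    define f where "f = max 0 (max (c - 1) (- c))"
    define g where "g = (if d0 \<in> {1..q - 2} then 1 else (0::int))"
    have k: "k \<ge> 0" by (simp add: k_def)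
    have f: "f \<ge> 0" "f \<ge> c - 1" "f \<ge> - c" by (auto simp: f_def)
    have qf: "q * f \<ge> 2 * f" using Suc.prems(1) f(1) by (intro mult_right_mono)
    have g: "g = 0 \<or> g = 1 \<and> 1 \<le> d0 \<and> d0 \<le> q - 2" by (auto simp: g_def)
    have up: "q * c' \<le> d0 + c + q * k" and lo: "q * c' \<ge> d0 + c - q * k"
      using c' A by (auto simp: k_def)
    \<comment> \<open>Only \<open>q * c'\<close> is known, so the estimate is made after multiplying
      by \<open>q\<close>; a product below \<open>q * 1\<close> forces the integer factor to be at
      most \<open>0\<close>.\<close>
    have "q * (c' - 1 + g - k - f) < q * 1"
      using g up f qf d0 Suc.prems(1) by (auto simp: algebra_simps)
    then have 1: "c' - 1 + g \<le> k + f"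
      using Suc.prems(1) by (simp add: mult_less_cancel_left)
    have "q * (- c' + g - k - f) < q * 1"
      using g lo f qf d0 Suc.prems(1) by (auto simp: algebra_simps)
    then have 2: "- c' + g \<le> k + f"
      using Suc.prems(1) by (simp add: mult_less_cancel_left)
    \<comment> \<open>Without terms and without slack, an inner digit would give
      \<open>0 < d0 + c < q\<close>, which is no multiple of \<open>q\<close>.\<close>
    have 3: "g \<le> k + f"
    proof (rule ccontr)
      assume "\<not> g \<le> k + f"
      then have z: "g = 1" "k = 0" "f = 0" using g k f by auto
      have "c = 0 \<or> c = 1" using f z by auto
      moreover have "A = 0" using A z by (simp add: k_def)
      ultimately have "0 < q * c'" "q * c' < q * 1" using c' g z by auto
      then show False using Suc.prems(1) by (simp add: mult_less_cancel_left zero_less_mult_iff)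
    qed
    from 1 2 3 show ?thesis unfolding k_def[symmetric] f_def[symmetric] g_def[symmetric]
      by auto
  qed
  ultimately show ?case
    using card_inner_digits_Suc[of q n N] Suc.prems(1) cardB
    by (auto simp: d0_def split: if_splits)
qed

text \<open>Induction on the top power: the rest stays below \<open>q ^ n\<close>, so nothing
  carries into position \<open>n\<close>, while \<open>q ^ n\<close> is a multiple of
  \<open>q * q ^ j\<close> and leaves each lower digit \<open>j\<close> unchanged.\<close>

lemma power_sum_digits:
  fixes q x :: int
  assumes "q \<ge> 2" "L \<le> n" "0 \<le> x" "x < q ^ L"
  shows "(\<Sum>i\<in>{L..<n}. q ^ i) + x < q ^ n
    \<and> (\<forall>j\<in>{L..<n}. ((\<Sum>i\<in>{L..<n}. q ^ i) + x) div q ^ j mod q = 1)"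
  using assms(2)
proof (induction n rule: dec_induct)
  case base
  then show ?case using assms by simp
next
  case (step n)
  define y where "y = (\<Sum>i\<in>{L..<n}. q ^ i) + x"
  have y: "0 \<le> y" "y < q ^ n" "\<forall>j\<in>{L..<n}. y div q ^ j mod q = 1"
    using step.IH assms by (auto simp: y_def intro!: sum_nonneg add_nonneg_nonneg)
  have eq: "(\<Sum>i\<in>{L..<Suc n}. q ^ i) + x = q ^ n + y"
    using step.hyps by (simp add: y_def)
  have "q ^ n + y < 2 * q ^ n" using y by simp
  also have "\<dots> \<le> q ^ Suc n" using assms by simp
  finally have 1: "q ^ n + y < q ^ Suc n" .
  have "(q ^ n + y) div q ^ j mod q = 1" if j: "j \<in> {L..<Suc n}" for j
  proof (cases "j = n")
    case True
    then show ?thesis using y assms by simp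
  next
    case False
    then have "q ^ n = q ^ j * (q * q ^ (n - j - 1))"
      using j by (simp flip: power_Suc power_add)
    then have "(q ^ n + y) div q ^ j = y div q ^ j + q * q ^ (n - j - 1)"
      using assms by simp
    then show ?thesis using y False j by simp
  qed
  then show ?case using 1 unfolding eq by blast
qed

section \<open>Levels in rooted trees\<close>

context rooted_tree
begin

text \<open>A natural-number version of the \<open>ereal\<close>-valued \<open>depth\<close>,
  faithful on vertices because each is reached from the root by a shortest walk.\<close>

definition level :: "'a \<Rightarrow> nat" where
  "level v = (THE n. depth v = ereal (real n))"

text \<open>Connectedness is defined through the symmetric closure; since arcs already come in
  opposite pairs, it yields reachability in \<open>G\<close> itself.\<close>

lemma mk_symmetric_eq: "mk_symmetric (with_proj G) = G"
proof -
  have "{(fst e, snd e), (snd e, fst e)} \<subseteq> parcs G" if "e \<in> parcs G" for e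
    using that arcs_symmetric[of "fst e" "snd e"] by simp
  then have "(\<Union>e\<in>parcs G. {(fst e, snd e), (snd e, fst e)}) = parcs G"
    by (intro equalityI UN_least) (auto simp: prod_eq_iff)
  then show ?thesis
    by (simp add: mk_symmetric_def)
qed

lemma reachable_root:
  assumes "v \<in> pverts G"
  shows "r \<rightarrow>\<^sup>*\<^bsub>with_proj G\<^esub> v"
  using connected assms root_in_verts
  unfolding connected_def mk_symmetric_eq strongly_connected_def by simp

lemma awalk_cost_1: "awalk_cost (\<lambda>_. 1) p = real (length p)"
  by (induction p) auto

lemma depth_path:
  assumes "v \<in> pverts G"
  obtains p where "awalk r p v" "depth v = ereal (real (length p))"
proof -
  obtain p where "apath r p v" "\<mu> (\<lambda>_. 1) r v = awalk_cost (\<lambda>_. 1) p"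
    using min_cost_awalk[OF reachable_root[OF assms], of "\<lambda>_. 1"] by auto
  then show ?thesis
    using that[of p] by (simp add: depth_def awalk_cost_1 apath_def)
qed

lemma depth_level:
  assumes "v \<in> pverts G"
  shows "depth v = ereal (real (level v))"
proof -
  obtain p where "awalk r p v" "depth v = ereal (real (length p))"
    using depth_path[OF assms] by blast
  then show ?thesis by (simp add: level_def)
qed

lemma level_root: "level r = 0"
proof -
  have "depth r \<le> ereal (awalk_cost (\<lambda>_. 1) [])"
    unfolding depth_def
    by (rule min_cost_le_walk_cost) (simp add: awalk_Nil_iff root_in_verts)
  then show ?thesis
    using depth_level[OF root_in_verts] by simp
qed

lemma level_0:
  assumes "v \<in> pverts G" "level v = 0"
  shows "v = r"
proof -
  obtain p where "awalk r p v" "depth v = ereal (real (length p))"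
    using depth_path[OF assms(1)] by blast
  then show ?thesis
    using depth_level[OF assms(1)] assms(2) by (simp add: awalk_Nil_iff)
qed

lemma children_eq:
  assumes "v \<in> pverts G"
  shows "children v = {w. (v, w) \<in> parcs G \<and> level w = Suc (level v)}"
proof -
  have "depth w = depth v + 1 \<longleftrightarrow> level w = Suc (level v)" if "(v, w) \<in> parcs G" for w
  proof -
    have "depth w = depth v + 1 \<longleftrightarrow> ereal (real (level w)) = ereal (real (Suc (level v)))"
      using depth_level[OF assms] depth_level[OF in_arcsD2[OF that]]
      by (simp add: one_ereal_def add.commute)
    then show ?thesis by (simp only: ereal.inject of_nat_eq_iff)
  qed
  then show ?thesis
    unfolding children_def nbhd_def by auto
qed

lemma children_subset: "children v \<subseteq> pverts G"
  by (auto simp: children_def nbhd_def dest: in_arcsD2)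

text \<open>The exact triangle equality for shortest distances provides the last arc of a shortest
  route from the root.\<close>

lemma ex_parent:
  assumes "v \<in> pverts G" "v \<noteq> r"
  obtains u where "u \<in> pverts G" "v \<in> children u" "(v, u) \<in> parcs G" "level v = Suc (level u)"
proof -
  obtain u e where u: "\<mu> (\<lambda>_. 1) r v = \<mu> (\<lambda>_. 1) r u + 1" and e: "arc e (u, v)"
    using mu_exact_triangle[OF assms(2) reachable_root[OF assms(1)], of "\<lambda>_. 1"]
    by (auto simp: one_ereal_def)
  from e have uv: "(u, v) \<in> parcs G"
    by (cases e) (auto simp: arc_def)
  then have "u \<in> pverts G" by (rule in_arcsD1)
  moreover have "v \<in> children u"
    using u uv by (simp add: children_def nbhd_def depth_def)
  moreover from this have "level v = Suc (level u)"
    using \<open>u \<in> pverts G\<close> by (simp add: children_eq)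
  ultimately show ?thesis
    using arcs_symmetric[OF uv] that by blast
qed

section \<open>Uniqueness of parents from acyclicity\<close>

lemma awalk_extend:
  assumes "awalk u p v" "(x, u) \<in> parcs G" "(v, y) \<in> parcs G"
  shows "awalk x ((x, u) # p @ [(v, y)]) y"
    and "awalk_verts x ((x, u) # p @ [(v, y)]) = x # awalk_verts u p @ [y]"
proof -
  have "awalk v [(v, y)] y"
    using assms(3) by (simp add: awalk_Cons_iff awalk_Nil_iff wellformed')
  with assms(1) have w: "awalk u (p @ [(v, y)]) y" by (rule awalk_appendI)
  then show "awalk x ((x, u) # p @ [(v, y)]) y"
    using assms(2) by (simp add: awalk_Cons_iff wellformed' del: awalk_append_iff)
  show "awalk_verts x ((x, u) # p @ [(v, y)]) = x # awalk_verts u p @ [y]"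
    using awalk_verts_append[OF w] by simp
qed

text \<open>Climb from both vertices to their parents until the two branches meet. The new endpoints
  are deeper than everything on the inner path, so it stays simple.\<close>

lemma ex_apath_below:
  assumes "u \<in> pverts G" "v \<in> pverts G" "level u = n" "level v = n"
  shows "\<exists>p. apath u p v \<and> (\<forall>x\<in>set (awalk_verts u p). level x \<le> n)"
  using assms
proof (induction n arbitrary: u v)
  case 0
  then show ?case
    by (intro exI[of _ "[]"]) (auto dest: level_0 simp: apath_Nil_iff)
next
  case (Suc n)
  show ?case
  proof (cases "u = v")
    case True
    then show ?thesis
      using Suc.prems by (intro exI[of _ "[]"]) (auto simp: apath_Nil_iff)
  next
    case False
    from Suc.prems have "u \<noteq> r" "v \<noteq> r" using level_root by auto
    obtain u' where u': "u' \<in> pverts G" "(u, u') \<in> parcs G" "level u = Suc (level u')"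
      using ex_parent[OF Suc.prems(1) \<open>u \<noteq> r\<close>] by blast
    obtain v' where v': "v' \<in> pverts G" "(v, v') \<in> parcs G" "level v = Suc (level v')"
      using ex_parent[OF Suc.prems(2) \<open>v \<noteq> r\<close>] by blast
    obtain p where p: "apath u' p v'" "\<forall>x\<in>set (awalk_verts u' p). level x \<le> n"
      using Suc.IH[of u' v'] u' v' Suc.prems by auto
    define p' where "p' = (u, u') # p @ [(v', v)]"
    have w: "awalk u' p v'" using p by (simp add: apath_def)
    have "awalk u p' v" and verts: "awalk_verts u p' = u # awalk_verts u' p @ [v]"
      unfolding p'_def using awalk_extend[OF w u'(2) arcs_symmetric[OF v'(2)]] by simp_all
    moreover have "u \<notin> set (awalk_verts u' p)" "v \<notin> set (awalk_verts u' p)"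
      using p(2) Suc.prems(3,4) by auto
    ultimately have "apath u p' v"
      using p(1) False unfolding apath_def verts by simp
    moreover have "\<forall>x\<in>set (awalk_verts u p'). level x \<le> Suc n"
      unfolding verts using p(2) Suc.prems by auto
    ultimately show ?thesis by (intro exI[of _ p'] conjI)
  qed
qed

text \<open>Two parents are joined by a path that stays above their common child; closing it through
  the child gives a cycle with at least one inner arc plus two more.\<close>

lemma parent_unique:
  assumes "u \<in> pverts G" "v \<in> pverts G" "w \<in> children u" "w \<in> children v"
  shows "u = v"
proof (rule ccontr)
  assume "u \<noteq> v"
  have uw: "(u, w) \<in> parcs G" "level w = Suc (level u)"
    and vw: "(v, w) \<in> parcs G" "level w = Suc (level v)"
    using assms by (auto simp: children_eq)
  obtain p where p: "apath u p v" "\<forall>x\<in>set (awalk_verts u p). level x \<le> level u"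
    using ex_apath_below[of u v "level u"] assms uw vw by auto
  define p' where "p' = (w, u) # p @ [(v, w)]"
  have w: "awalk u p v" using p by (simp add: apath_def)
  have "p \<noteq> []" using w \<open>u \<noteq> v\<close> by (auto simp: awalk_Nil_iff)
  have "awalk w p' w" "awalk_verts w p' = w # awalk_verts u p @ [w]"
    unfolding p'_def using awalk_extend[OF w arcs_symmetric[OF uw(1)] vw(1)] by simp_all
  moreover have "distinct (awalk_verts u p @ [w])"
    using p uw by (auto simp: apath_def)
  ultimately have "cycle p'" unfolding cycle_def by (intro exI[of _ w]) (simp add: p'_def)
  moreover have "3 \<le> length p'"
    using \<open>p \<noteq> []\<close> by (cases p) (auto simp: p'_def)
  ultimately show False using acyclic by blast
qed

end

section \<open>Counting vertices along the boundary\<close>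

context complete_qary_tree
begin

text \<open>The locale does not mention vertices deeper than \<open>d\<close>; following parents
  shows that one would force a vertex at depth \<open>d\<close> to have a child, against
  \<open>leaves\<close>.\<close>

lemma level_le:
  assumes "v \<in> pverts G"
  shows "level v \<le> d"
  using assms
proof (induction "level v" arbitrary: v)
  case 0
  then show ?case by simp
next
  case (Suc n)
  then have "v \<noteq> r" by (auto simp: level_root)
  then obtain u where u: "u \<in> pverts G" "v \<in> children u" "level v = Suc (level u)"
    using ex_parent[OF Suc.prems] by blast
  then have "level u \<le> d" using Suc.hyps(1)[of u] Suc.hyps(2) by simp
  moreover have "level u \<noteq> d" using leaves[of u] depth_level[of u] u by force
  ultimately show ?case using u by simp
qed

lemma card_children_eq:
  assumes "v \<in> pverts G"
  shows "card (children v) = (if level v = d then 0 else q)"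
proof (cases "level v = d")
  case True
  then have "children v = {}"
    using assms by (intro leaves) (simp_all add: depth_level)
  then show ?thesis using True by simp
next
  case False
  then have "level v < d" using level_le[OF assms] by simp
  then have "card (children v) = q"
    using assms by (intro card_children) (simp_all add: depth_level)
  then show ?thesis using False by simp
qed

section \<open>Subtree weights and their telescoping\<close>

definition weight :: "'a \<Rightarrow> int" where
  "weight v = int q ^ Suc (d - level v) - 1"

lemma weight_child:
  assumes "v \<in> pverts G" "w \<in> children v"
  shows "weight w = int q ^ (d - level v) - 1"
proof -
  have "level w = Suc (level v)" "w \<in> pverts G"
    using assms children_subset[of v] by (auto simp: children_eq)
  then have "Suc (d - level w) = d - level v" using level_le[of w] by simp
  then show ?thesis by (simp only: weight_def)
qed

lemma weight_recursion:
  assumes "v \<in> pverts G"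
  shows "int q - 1 = weight v - (\<Sum>w\<in>children v. weight w)"
proof -
  have "(\<Sum>w\<in>children v. weight w) = int (card (children v)) * (int q ^ (d - level v) - 1)"
    using weight_child[OF assms] by simp
  \<comment> \<open>For a leaf the number of children is \<open>0\<close> rather than
    \<open>q\<close>, but the second factor is then \<open>q ^ 0 - 1 = 0\<close>.\<close>
  also have "\<dots> = int q * (int q ^ (d - level v) - 1)"
    using card_children_eq[OF assms] by simp
  finally show ?thesis by (simp add: weight_def algebra_simps)
qed

lemma finite_children: "finite (children v)"
  using children_subset pair_finite_verts by (rule finite_subset)

text \<open>By \<open>parent_unique\<close> distinct vertices have disjoint sets of children, so no
  vertex is counted twice.\<close>

lemma sum_children:
  fixes f :: "'a \<Rightarrow> int"
  assumes "A \<subseteq> pverts G"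
  shows "(\<Sum>v\<in>A. \<Sum>w\<in>children v \<inter> X. f w) = sum f ((\<Union>v\<in>A. children v) \<inter> X)"
proof -
  have "(children u \<inter> X) \<inter> (children v \<inter> X) = {}" if "u \<in> A" "v \<in> A" "u \<noteq> v" for u v
    using parent_unique[of u v] that assms by blast
  then have "sum f (\<Union>v\<in>A. children v \<inter> X) = (\<Sum>v\<in>A. \<Sum>w\<in>children v \<inter> X. f w)"
    using finite_subset[OF assms pair_finite_verts] finite_children
    by (intro sum.UNION_disjoint) auto
  then show ?thesis by simp
qed

lemma Union_children: "(\<Union>v\<in>pverts G. children v) = pverts G - {r}"
proof -
  have "r \<notin> children v" if "v \<in> pverts G" for v
    using that by (simp add: children_eq level_root)
  moreover have "\<exists>u\<in>pverts G. v \<in> children u" if "v \<in> pverts G" "v \<noteq> r" for v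
    using ex_parent[OF that] by blast
  ultimately show ?thesis
    using children_subset by blast
qed

text \<open>Sum \<open>weight_recursion\<close> over \<open>S\<close>. Edges inside \<open>S\<close>
  cancel; an edge from an outside parent to a child in \<open>S\<close> is charged to the parent
  through \<open>c\<close>, one from a parent in \<open>S\<close> to an outside child is charged to
  the child through \<open>e\<close>.\<close>

lemma card_boundary_formula:
  assumes S: "S \<subseteq> pverts G"
  defines "B \<equiv> vertex_boundary G S"
  obtains c e :: "'a \<Rightarrow> int"
  where "\<And>v. v \<in> B \<Longrightarrow> 0 \<le> c v \<and> c v \<le> int q" "\<And>v. v \<in> B \<Longrightarrow> e v \<in> {0, 1}"
    and "(int q - 1) * int (card S) = (if r \<in> S then int q ^ Suc d - 1 else 0)
      + (\<Sum>v\<in>B. c v * (int q ^ (d - level v) - 1) - e v * (int q ^ Suc (d - level v) - 1))"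
proof -
  define V where "V = pverts G"
  have V: "finite V" "S \<subseteq> V" and finS: "finite S"
    using S pair_finite_verts finite_subset[OF S pair_finite_verts] by (simp_all add: V_def)
  define c where "c v = int (card (children v \<inter> S))" for v
  define P where "P = (\<Union>v\<in>S. children v)"
  define e :: "'a \<Rightarrow> int" where "e v = (if v \<in> P then 1 else 0)" for v
  have BV: "B \<subseteq> V - S" by (auto simp: B_def vertex_boundary_def V_def)
  have "(\<Sum>w\<in>S. weight w)
      = (if r \<in> S then weight r else 0) + (\<Sum>w\<in>S - {r}. weight w)"
    using finS by (auto simp: sum.remove)
  \<comment> \<open>Every member of \<open>S\<close> other than the root has a parent, so the
    weights can be regrouped by parent.\<close>
  also have "S - {r} = (\<Union>v\<in>V. children v) \<inter> S"
    using S Union_children by (auto simp: V_def)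
  also have "(\<Sum>w\<in>(\<Union>v\<in>V. children v) \<inter> S. weight w)
      = (\<Sum>v\<in>V. \<Sum>w\<in>children v \<inter> S. weight w)"
    by (rule sum_children[symmetric]) (simp add: V_def)
  also have "\<dots> = (\<Sum>v\<in>V - S. \<Sum>w\<in>children v \<inter> S. weight w)
      + (\<Sum>v\<in>S. \<Sum>w\<in>children v \<inter> S. weight w)"
    using V by (rule sum.subset_diff[rotated])
  finally have 1: "(\<Sum>w\<in>S. weight w) = (if r \<in> S then weight r else 0)
      + (\<Sum>v\<in>V - S. \<Sum>w\<in>children v \<inter> S. weight w)
      + (\<Sum>v\<in>S. \<Sum>w\<in>children v \<inter> S. weight w)" by simp
  have 2: "(\<Sum>v\<in>S. \<Sum>w\<in>children v. weight w) = (\<Sum>v\<in>S. \<Sum>w\<in>children v \<inter> S. weight w)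
      + (\<Sum>v\<in>S. \<Sum>w\<in>children v \<inter> - S. weight w)"
    unfolding sum.distrib[symmetric]
  proof (rule sum.cong[OF refl])
    fix v
    show "(\<Sum>w\<in>children v. weight w)
      = (\<Sum>w\<in>children v \<inter> S. weight w) + (\<Sum>w\<in>children v \<inter> - S. weight w)"
      using finite_children[of v] sum.Int_Diff[of "children v" weight S] by (simp add: Diff_eq)
  qed
  have "(\<Sum>v\<in>V - S. \<Sum>w\<in>children v \<inter> S. weight w)
      = (\<Sum>v\<in>V - S. c v * (int q ^ (d - level v) - 1))"
    by (rule sum.cong) (auto simp: c_def V_def weight_child)
  also have "\<dots> = (\<Sum>v\<in>B. c v * (int q ^ (d - level v) - 1))"
  \<comment> \<open>A vertex outside both \<open>S\<close> and its boundary has no child in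
    \<open>S\<close>, hence coefficient \<open>0\<close>.\<close>
  proof (rule sum.mono_neutral_right)
    show "\<forall>v\<in>V - S - B. c v * (int q ^ (d - level v) - 1) = 0"
    proof
      fix v assume "v \<in> V - S - B"
      then have "children v \<inter> S = {}"
        by (auto simp: B_def vertex_boundary_def V_def children_def)
      then show "c v * (int q ^ (d - level v) - 1) = 0" by (simp add: c_def)
    qed
  qed (use V BV in auto)
  finally have 3: "(\<Sum>v\<in>V - S. \<Sum>w\<in>children v \<inter> S. weight w)
      = (\<Sum>v\<in>B. c v * (int q ^ (d - level v) - 1))" .
  have "P \<inter> - S \<subseteq> B"
  proof
    fix w assume w: "w \<in> P \<inter> - S"
    then obtain v where v: "v \<in> S" "w \<in> children v" by (auto simp: P_def)
    then have "(w, v) \<in> parcs G" "w \<in> pverts G"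
      using children_subset[of v] arcs_symmetric[of v w] by (auto simp: children_def nbhd_def)
    then show "w \<in> B" using w v by (auto simp: B_def vertex_boundary_def nbhd_def)
  qed
  have "(\<Sum>v\<in>S. \<Sum>w\<in>children v \<inter> - S. weight w) = (\<Sum>w\<in>P \<inter> - S. weight w)"
    unfolding P_def using S by (rule sum_children)
  also have "\<dots> = (\<Sum>w\<in>P \<inter> - S. e w * weight w)"
    by (rule sum.cong) (auto simp: e_def)
  also have "\<dots> = (\<Sum>w\<in>B. e w * weight w)"
    by (rule sum.mono_neutral_left)
      (use V BV \<open>P \<inter> - S \<subseteq> B\<close> in \<open>auto simp: e_def intro: finite_subset\<close>)
  finally have 4: "(\<Sum>v\<in>S. \<Sum>w\<in>children v \<inter> - S. weight w) = (\<Sum>w\<in>B. e w * weight w)" .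
  have "(int q - 1) * int (card S) = (\<Sum>v\<in>S. int q - 1)" by simp
  also have "\<dots> = (\<Sum>v\<in>S. weight v - (\<Sum>w\<in>children v. weight w))"
    by (rule sum.cong) (use S weight_recursion in auto)
  also have "\<dots> = (\<Sum>v\<in>S. weight v) - (\<Sum>v\<in>S. \<Sum>w\<in>children v. weight w)"
    by (rule sum_subtractf)
  also have "\<dots> = (if r \<in> S then weight r else 0)
      + (\<Sum>v\<in>B. c v * (int q ^ (d - level v) - 1)) - (\<Sum>w\<in>B. e w * weight w)"
    unfolding 1 2 3 4 by simp
  finally have "(int q - 1) * int (card S) = (if r \<in> S then int q ^ Suc d - 1 else 0)
      + (\<Sum>v\<in>B. c v * (int q ^ (d - level v) - 1) - e v * (int q ^ Suc (d - level v) - 1))"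
    by (simp add: sum_subtractf weight_def level_root)
  moreover have "0 \<le> c v \<and> c v \<le> int q" if "v \<in> B" for v
  proof -
    have "card (children v \<inter> S) \<le> card (children v)"
      by (intro card_mono finite_children) auto
    then show ?thesis
      using card_children_eq[of v] that BV by (auto simp: c_def V_def split: if_splits)
  qed
  moreover have "e v \<in> {0, 1}" for v by (simp add: e_def)
  ultimately show ?thesis using that by blast
qed

text \<open>The full vertex set has empty boundary, so only the root term survives.\<close>

lemma card_pverts: "(int q - 1) * int (card (pverts G)) = int q ^ Suc d - 1"
proof -
  have "vertex_boundary G (pverts G) = {}" by (auto simp: vertex_boundary_def)
  then show ?thesis
    using card_boundary_formula[of "pverts G"] root_in_verts by auto
qed

section \<open>A set size that forces a large boundary\<close>

lemma ex_Phi_V_at: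
  assumes "s \<le> card (pverts G)"
  obtains S where "S \<subseteq> pverts G" "card S = s" "card (vertex_boundary G S) \<le> Phi_V G"
proof -
  define F where "F = {card (vertex_boundary G S) |S. S \<subseteq> pverts G \<and> card S = s}"
  have "F = (\<lambda>S. card (vertex_boundary G S)) ` {S \<in> Pow (pverts G). card S = s}"
    by (auto simp: F_def)
  then have "finite F" using pair_finite_verts by simp
  moreover have "F \<noteq> {}"
    using obtain_subset_with_card_n[OF assms] by (auto simp: F_def)
  ultimately have "Phi_V_at G s \<in> F" unfolding Phi_V_at_def F_def by (rule Min_in)
  moreover have "Phi_V_at G s \<le> Phi_V G"
    unfolding Phi_V_def using assms by (intro Max_ge) auto
  ultimately show ?thesis using that by (auto simp: F_def)
qed

lemma Phi_V_power_le:
  assumes "q \<ge> 3" "Phi_V G < d"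
  shows "q ^ (d - Phi_V G) \<le> 2 * q * d"
proof (rule ccontr)
  assume "\<not> q ^ (d - Phi_V G) \<le> 2 * q * d"
  define b where "b = Phi_V G"
  define L where "L = d - b"
  define Q where "Q = int q"
  \<comment> \<open>Ones in positions \<open>L\<close> to \<open>d\<close>: these are
    \<open>b + 1\<close> positions, one more than a boundary of size \<open>b\<close> can account
    for.\<close>
  define M where "M = (\<Sum>i\<in>{L..<Suc d}. Q ^ i)"
  have Q: "Q \<ge> 3" using assms by (simp add: Q_def)
  have b: "b \<le> d - 1" "b < d" using assms by (auto simp: b_def)
  have "2 * q * d < q ^ L"
    using \<open>\<not> _\<close> by (simp add: L_def b_def)
  then have "int (2 * q * d) < int (q ^ L)" by (simp only: of_nat_less_iff)
  then have QL: "2 * Q * int d < Q ^ L" by (simp add: Q_def)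
  \<comment> \<open>The total error that the low digits must absorb: \<open>b + (Q - 1)\<close> from
    the choice of \<open>t\<close> and \<open>Q * b + 1\<close> from the correction
    \<open>R\<close>.\<close>
  have "(Q + 1) * int b + Q \<le> (Q + 1) * (int d - 1) + Q"
    using Q b by (intro add_right_mono mult_left_mono) auto
  also have "\<dots> < (Q + 1) * int d" by (simp add: algebra_simps)
  also have "\<dots> \<le> 2 * Q * int d" using Q by (intro mult_right_mono) auto
  finally have bound: "(Q + 1) * int b + Q < Q ^ L" using QL by simp
  have "M \<ge> 0" unfolding M_def using Q by (intro sum_nonneg) simp
  \<comment> \<open>Makes \<open>(Q - 1) * t\<close> the least multiple of \<open>Q - 1\<close>
    exceeding \<open>M + b\<close>; the margin \<open>b\<close> covers a correction \<open>R\<close>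
    as low as \<open>- b\<close>.\<close>
  define t where "t = (M + int b) div (Q - 1) + 1"
  have "t \<ge> 0" using Q \<open>M \<ge> 0\<close> by (simp add: t_def pos_imp_zdiv_nonneg_iff)
  define s where "s = nat t"
  have s: "int s = t" using \<open>t \<ge> 0\<close> by (simp add: s_def)
  have "(Q - 1) * t = M + int b + (Q - 1) - (M + int b) mod (Q - 1)"
    by (simp add: t_def algebra_simps flip: minus_mult_div_eq_mod)
  moreover have "0 \<le> (M + int b) mod (Q - 1)" "(M + int b) mod (Q - 1) < Q - 1"
    using Q by simp_all
  ultimately have t: "M + int b < (Q - 1) * t" "(Q - 1) * t \<le> M + int b + (Q - 1)"
    by linarith+
  have QL1: "Q ^ L \<ge> 1" using Q by simp
  \<comment> \<open>Needed for \<open>s\<close> to be an admissible size: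
    \<open>Q ^ Suc d - 1\<close> is \<open>Q - 1\<close> times the number of vertices.\<close>
  have top: "M + (Q ^ L - 1) < Q ^ Suc d"
    using power_sum_digits[of Q L "Suc d" "Q ^ L - 1"] Q QL1 by (simp add: M_def L_def)
  have "int b \<le> (Q + 1) * int b" using Q by (simp add: mult_le_cancel_right1)
  then have "(Q - 1) * t \<le> Q ^ Suc d - 1" using t bound top by linarith
  also have "\<dots> = (Q - 1) * int (card (pverts G))" using card_pverts by (simp add: Q_def)
  finally have "int s \<le> int (card (pverts G))" using Q s by (simp add: mult_le_cancel_left)
  then obtain S where S: "S \<subseteq> pverts G" "card S = s" "card (vertex_boundary G S) \<le> b"
    using ex_Phi_V_at[of s] unfolding b_def by auto
  define B where "B = vertex_boundary G S"
  have finB: "finite B" unfolding B_def vertex_boundary_def using pair_finite_verts by simp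
  obtain c e :: "'a \<Rightarrow> int" where ce: "\<And>v. v \<in> B \<Longrightarrow> 0 \<le> c v \<and> c v \<le> Q"
      "\<And>v. v \<in> B \<Longrightarrow> e v \<in> {0, 1}"
    and eq: "(Q - 1) * int (card S) = (if r \<in> S then Q ^ Suc d - 1 else 0)
      + (\<Sum>v\<in>B. c v * (Q ^ (d - level v) - 1) - e v * (Q ^ Suc (d - level v) - 1))"
    by (rule card_boundary_formula[OF S(1), folded B_def Q_def]) (rule that)
  define \<epsilon> :: int where "\<epsilon> = (if r \<in> S then 1 else 0)"
  \<comment> \<open>Collects all the \<open>- 1\<close> summands of the boundary formula, so that
    \<open>N\<close> is a sum of pure power terms modulo \<open>Q ^ Suc d\<close>.\<close>
  define R where "R = \<epsilon> + (\<Sum>v\<in>B. c v - e v)"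
  define N where "N = (Q - 1) * t + R"
  have "N = \<epsilon> * Q ^ Suc d + (\<Sum>v\<in>B. (c v - Q * e v) * Q ^ (d - level v))"
    using eq S(2) s unfolding N_def R_def \<epsilon>_def
    by (auto simp: algebra_simps sum.distrib sum_subtractf)
  then have "Q ^ Suc d dvd N + 0 - (\<Sum>v\<in>B. (c v - Q * e v) * Q ^ (d - level v))"
    by simp
  moreover have "\<bar>c v - Q * e v\<bar> \<le> Q" if "v \<in> B" for v
    using ce(1)[OF that] ce(2)[OF that] Q by auto
  \<comment> \<open>The initial carry is \<open>0\<close>, so the slack vanishes.\<close>
  ultimately have "int (card (inner_digits Q (Suc d) N)) \<le> int (card B) + max 0 (max (0 - 1) (- 0))"
    using Q finB by (intro card_inner_digits_le) auto
  then have few: "card (inner_digits Q (Suc d) N) \<le> b" using S by (simp add: B_def)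
  have "(\<Sum>v\<in>B. c v - e v) \<le> (\<Sum>v\<in>B. Q)"
    by (rule sum_mono) (use ce in force)
  also have "\<dots> \<le> Q * int b" using S(3) Q by (simp add: B_def mult.commute)
  finally have R1: "R \<le> Q * int b + 1" by (simp add: R_def \<epsilon>_def)
  have "- int b \<le> (\<Sum>v\<in>B. - 1)" using S(3) by (simp add: B_def)
  also have "\<dots> \<le> (\<Sum>v\<in>B. c v - e v)"
    by (rule sum_mono) (use ce in force)
  finally have R2: "- int b \<le> R" by (simp add: R_def \<epsilon>_def)
  have "0 \<le> N - M" "N - M < Q ^ L"
    using R1 R2 t bound by (auto simp: N_def algebra_simps)
  then have "\<forall>j\<in>{L..<Suc d}. N div Q ^ j mod Q = 1"
    using power_sum_digits[of Q L "Suc d" "N - M"] Q by (simp add: M_def L_def)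
  \<comment> \<open>The digit \<open>1\<close> is inner because \<open>Q\<close> is at least
    \<open>3\<close>.\<close>
  then have "{L..<Suc d} \<subseteq> inner_digits Q (Suc d) N"
    using Q by (auto simp: inner_digits_def)
  then have "card {L..<Suc d} \<le> card (inner_digits Q (Suc d) N)"
    by (intro card_mono) (auto simp: inner_digits_def)
  then show False using few b by (simp add: L_def)
qed

end

theorem theorem3p2:
  fixes T :: "'a pair_pre_digraph" and r :: 'a and q d :: nat
  assumes "q \<in> {3, 4}" and "d \<ge> 1"
    and "complete_qary_tree T r q d"
  shows "real (Phi_V T) \<ge> real d - log (real q) (real d) - (log (real q) 2 + 1)"
proof -
  interpret complete_qary_tree T r q d by fact
  have q: "q \<ge> 3" using assms(1) by auto
  have log: "log q (2 * q * d) = log q d + (log q 2 + 1)"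
    using q assms(2) by (simp add: log_mult)
  show ?thesis
  \<comment> \<open>If the value is at least \<open>d\<close>, the claim follows from nonnegative
    logarithms; otherwise take logarithms in \<open>Phi_V_power_le\<close>.\<close>
  proof (cases "Phi_V T < d")
    case False
    have "log q d \<ge> 0" "log q 2 \<ge> 0" using q assms(2) by auto
    then show ?thesis using False by simp
  next
    case True
    have "q ^ (d - Phi_V T) \<le> 2 * q * d"
      using q True by (rule Phi_V_power_le)
    then have "real (q ^ (d - Phi_V T)) \<le> real (2 * q * d)" by (simp only: of_nat_le_iff)
    then have "log q (real q ^ (d - Phi_V T)) \<le> log q (2 * q * d)"
      using q by (intro log_mono) auto
    then have "real (d - Phi_V T) \<le> log q (2 * q * d)"
      using q by (simp add: log_nat_power)
    then show ?thesis using log True by (simp add: of_nat_diff)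
  qed
qed

end
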